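(* Let $\mathcal{P}=(p_1,p_2,\dots)$ be a probability distribution on $\mathbb{N}$ with $p_1\ge p_2\ge p_3\ge\cdots$ and with unbounded support, and let $\eta_t$ be the number of active bits at time $t\ge0$ in the continuous-time version of either the Binary Flipping (BF) model or the Damaged Bits (DB) model with distribution $\mathcal{P}$. For both models, whenever $\mathbf{E}\,\eta_t\to\infty$ as $t\to\infty$, then also $\mathbf{var}\,\eta_t\to\infty$ as $t\to\infty$, and $$\frac{\eta_t-\mathbf{E}\,\eta_t}{\sqrt{\mathbf{var}\,\eta_t}}\ \to\ \mathcal{N}(0,1)\quad\text{in distribution as }t\to\infty .$$ In the BF model the condition $\mathbf{E}\,\eta_t\to\infty$ is always fulfilled. In the DB model a sufficient condition for $\mathbf{E}\,\eta_t\to\infty$ is that $p_k\sim C\exp(-\alpha k^\gamma)$ as $k\to\infty$ for some constants $C>0$, $\alpha>0$, $\gamma\in(0,1)$.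
   Context: $\mathbb{N}=\{1,2,\dots\}$; $a_k\sim b_k$ means $a_k/b_k\to1$ as $k\to\infty$; $\mathcal{N}(0,1)$ is the standard normal law. Continuous-time models: the bits $\zeta_t=(\zeta_t^1,\zeta_t^2,\dots)$, $t\ge0$, are independent continuous-time Markov jump processes, all started from state $0$. In the BF model, $\zeta^k_t\in\{0,1\}$ ($0$ = idle, $1$ = active) and bit $k$ switches to the opposite state at the times of a Poisson process of rate $p_k$. In the DB model, $\zeta^k_t\in\{0,1,2\}$ ($0$ = idle, $1$ = active, $2$ = damaged) and bit $k$ changes $0\to1\to2$, with each change occurring at rate $p_k$, and then stays in state $2$ forever. The number of active bits is $\eta_t=\#\{k\in\mathbb{N}:\zeta^k_t=1\}$. *)

theory Defs
  imports "HOL-Probability.Probability" "HOL-Library.Landau_Symbols"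
begin

text \<open>
  A Poisson process of rate \<open>r\<close>, given through its counting process \<open>N t\<close> for \<open>t \<ge> 0\<close>. The
  continuity is with respect to the discrete topology on \<open>nat\<close>, so the paths are right-continuous
  step functions. That the jumps have size one (almost surely) follows.
\<close>
definition poisson_process :: "'a measure \<Rightarrow> real \<Rightarrow> (real \<Rightarrow> 'a \<Rightarrow> nat) \<Rightarrow> bool" where
  "poisson_process M r N \<longleftrightarrow>
     (\<forall>t\<ge>0. N t \<in> M \<rightarrow>\<^sub>M count_space UNIV) \<and>
     (AE \<omega> in M. N 0 \<omega> = 0 \<and> mono_on {0..} (\<lambda>t. N t \<omega>) \<and>
        (\<forall>t\<ge>0. continuous (at_right t) (\<lambda>s. N s \<omega>))) \<and>
     (\<forall>s t. 0 \<le> s \<and> s < t \<longrightarrow>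
        distr M (count_space UNIV) (\<lambda>\<omega>. N t \<omega> - N s \<omega>) = measure_pmf (poisson_pmf (r * (t - s)))) \<and>
     (\<forall>\<tau> :: nat \<Rightarrow> real. 0 \<le> \<tau> 0 \<and> mono \<tau> \<longrightarrow>
        prob_space.indep_vars M (\<lambda>_. count_space UNIV)
          (\<lambda>i \<omega>. N (\<tau> (Suc i)) \<omega> - N (\<tau> i) \<omega>) UNIV)"

text \<open>Starting from 0, the bit switches between 0 and 1 at each point of a Poisson process.\<close>
definition bf_bit :: "'a measure \<Rightarrow> real \<Rightarrow> (real \<Rightarrow> 'a \<Rightarrow> nat) \<Rightarrow> bool" where
  "bf_bit M r X \<longleftrightarrow>
     (\<forall>t\<ge>0. X t \<in> M \<rightarrow>\<^sub>M count_space {0, 1}) \<and>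
     (\<exists>N. poisson_process M r N \<and> (AE \<omega> in M. \<forall>t\<ge>0. X t \<omega> = N t \<omega> mod 2))"

text \<open>
  The Markov jump process \<open>0 \<rightarrow> 1 \<rightarrow> 2\<close> with both transitions at rate \<open>r\<close> and absorbing state 2,
  described by its holding times: \<open>U\<close> in state 0 and \<open>V\<close> in state 1 are independent and
  exponentially distributed with parameter \<open>r\<close>.
\<close>
definition db_bit :: "'a measure \<Rightarrow> real \<Rightarrow> (real \<Rightarrow> 'a \<Rightarrow> nat) \<Rightarrow> bool" where
  "db_bit M r X \<longleftrightarrow>
     (\<forall>t\<ge>0. X t \<in> M \<rightarrow>\<^sub>M count_space {0, 1, 2}) \<and>
     (\<exists>U V. distributed M lborel U (exponential_density r) \<and>
            distributed M lborel V (exponential_density r) \<and>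
            prob_space.indep_var M borel U borel V \<and>
            (AE \<omega> in M. \<forall>t\<ge>0. X t \<omega> =
               (if t < U \<omega> then 0 else if t < U \<omega> + V \<omega> then 1 else 2)))"

text \<open>
  Independence of the processes \<open>(\<zeta> k t)\<^bsub>t \<ge> 0\<^esub>\<close>, \<open>k \<ge> 1\<close>, with values in \<open>S\<close>: each of them is
  regarded as a random element of the product space \<open>S\<^bsup>[0,\<infinity>)\<^esup>\<close>.
\<close>
definition indep_processes ::
    "'a measure \<Rightarrow> nat set \<Rightarrow> (nat \<Rightarrow> real \<Rightarrow> 'a \<Rightarrow> nat) \<Rightarrow> bool" where
  "indep_processes M S \<zeta> \<longleftrightarrow>
     prob_space.indep_vars M (\<lambda>_. PiM {0..} (\<lambda>_. count_space S))
       (\<lambda>k \<omega>. \<lambda>t\<in>{0..}. \<zeta> k t \<omega>) {1..}"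

definition bf_model :: "'a measure \<Rightarrow> nat pmf \<Rightarrow> (nat \<Rightarrow> real \<Rightarrow> 'a \<Rightarrow> nat) \<Rightarrow> bool" where
  "bf_model M P \<zeta> \<longleftrightarrow>
     (\<forall>k\<ge>1. bf_bit M (pmf P k) (\<zeta> k)) \<and> indep_processes M {0, 1} \<zeta>"

definition db_model :: "'a measure \<Rightarrow> nat pmf \<Rightarrow> (nat \<Rightarrow> real \<Rightarrow> 'a \<Rightarrow> nat) \<Rightarrow> bool" where
  "db_model M P \<zeta> \<longleftrightarrow>
     (\<forall>k\<ge>1. db_bit M (pmf P k) (\<zeta> k)) \<and> indep_processes M {0, 1, 2} \<zeta>"

text \<open>
  In both models the set counted here is almost surely finite: each bit \<open>k\<close> has left state 0 by
  time \<open>t\<close> with probability at most \<open>t * pmf P k\<close>, which is summable. So the convention that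
  infinite sets have cardinality 0 only matters on a null set.
\<close>
definition active_bits :: "(nat \<Rightarrow> real \<Rightarrow> 'a \<Rightarrow> nat) \<Rightarrow> real \<Rightarrow> 'a \<Rightarrow> real" where
  "active_bits \<zeta> t \<omega> = real (card {k. 1 \<le> k \<and> \<zeta> k t \<omega> = 1})"

text \<open>
  Weak convergence of distributions on the real line along an arbitrary filter;
  \<^const>\<open>weak_conv_m\<close> is the case of the filter \<^const>\<open>sequentially\<close>.
\<close>
definition weak_conv_along :: "'i filter \<Rightarrow> ('i \<Rightarrow> real measure) \<Rightarrow> real measure \<Rightarrow> bool" where
  "weak_conv_along F \<mu> \<nu> \<longleftrightarrow>
     (\<forall>x. isCont (cdf \<nu>) x \<longrightarrow> ((\<lambda>i. cdf (\<mu> i) x) \<longlongrightarrow> cdf \<nu> x) F)"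

end

theory Submission
  imports Defs
begin

text \<open>
  At a fixed time \<open>t\<close> the number of active bits is a sum of independent indicators. A bit of rate \<open>r\<close> is
  active with probability \<open>(1 - exp (- 2 * r * t)) / 2\<close> in the flipping model (the probability that a
  Poisson variable is odd) and \<open>r * t * exp (- r * t)\<close> in the damaging model (the difference of two
  Erlang tails); see \<open>prob_bf_bit_active\<close> and \<open>prob_db_bit_active\<close>. Both are at most \<open>r * t\<close>, so the
  probabilities are summable, and at most 1/2, so the variance is at least half the mean and diverges
  with it (\<open>variance_ge_half_expectation\<close>).

  For sums of independent indicators a divergent variance \<open>\<sigma>\<^sup>2\<close> is enough for asymptotic normality. Each
  factor of the characteristic function differs from the corresponding Gaussian factor by at most
  a constant times its share of the variance times \<open>\<bar>u\<bar> ^ 3 + u ^ 4\<close>; at \<open>u = \<theta> / \<sigma>\<close> these errors add up to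
  \<open>O(1 / \<sigma>)\<close> (\<open>char_occurrences_approx\<close>, \<open>clt_occurrences\<close>). The sums are infinite, but have almost
  surely finitely many nonzero terms, so mean, variance and this estimate are limits of the finite case.

  The mean diverges in the flipping model because each of the infinitely many bits is
  eventually active with probability close to 1/2. In the damaging model, rates asymptotic to a stretched
  exponential have consecutive ratios tending to 1, so for large \<open>t\<close> there are arbitrarily many
  bits with \<open>p k * t\<close> between 1/2 and 1, each contributing a fixed amount (\<open>expectation_at_top_db\<close>).
\<close>

section \<open>Independent random variables\<close>

lemma (in prob_space) indep_vars_reindex_inj:
  assumes f: "inj_on f I" and indep: "indep_vars M' X (f ` I)"
  shows "indep_vars (\<lambda>i. M' (f i)) (\<lambda>i. X (f i)) I"
  unfolding indep_vars_def2
proof (intro conjI ballI)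
  fix i assume "i \<in> I"
  then show "random_variable (M' (f i)) (X (f i))"
    using indep unfolding indep_vars_def2 by auto
next
  let ?F = "\<lambda>j. {X j -` A \<inter> space M |A. A \<in> sets (M' j)}"
  have F: "indep_sets ?F (f ` I)"
    using indep unfolding indep_vars_def2 by auto
  show "indep_sets (\<lambda>i. ?F (f i)) I"
  proof (rule indep_setsI)
    fix i assume "i \<in> I"
    then show "?F (f i) \<subseteq> events"
      using F unfolding indep_sets_def by blast
  next
    fix A J assume J: "J \<noteq> {}" "J \<subseteq> I" "finite J" and A: "\<forall>j\<in>J. A j \<in> ?F (f j)"
    define B where "B j = A (inv_into I f j)" for j
    have B: "B (f j) = A j" if "j \<in> J" for j
      using f J that unfolding B_def by (auto simp: inv_into_f_f)
    have inj: "inj_on f J"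
      using f J inj_on_subset by blast
    have "prob (\<Inter>j\<in>f ` J. B j) = (\<Prod>j\<in>f ` J. prob (B j))"
      by (rule indep_setsD[OF F]) (use J A B in auto)
    then show "prob (\<Inter>(A ` J)) = (\<Prod>j\<in>J. prob (A j))"
      using B by (simp add: prod.reindex[OF inj])
  qed
qed

lemma (in prob_space) indep_vars_cong_space:
  assumes "indep_vars M' X I" and eq: "\<And>i \<omega>. i \<in> I \<Longrightarrow> \<omega> \<in> space M \<Longrightarrow> X i \<omega> = Y i \<omega>"
  shows "indep_vars M' Y I"
proof -
  have "X i -` B \<inter> space M = Y i -` B \<inter> space M" if "i \<in> I" for i B
    using eq[OF that] by auto
  moreover have "random_variable (M' i) (X i) \<longleftrightarrow> random_variable (M' i) (Y i)" if "i \<in> I" for i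
    by (rule measurable_cong) (rule eq[OF that])
  ultimately show ?thesis
    using assms(1) unfolding indep_vars_def2 by (simp cong: indep_sets_cong)
qed

section \<open>Counting independent events\<close>

text \<open>
  A sequence of independent events with summable probabilities. By the first Borel--Cantelli lemma
  almost surely only finitely many of them occur, so the number of occurrences is the almost sure
  limit of its partial sums, and every identity and estimate for finite sums passes to the limit.
  Independence is stated for the indicator functions, whose characteristic functions then multiply.
\<close>
locale indep_event_family = prob_space +
  fixes A :: "nat \<Rightarrow> 'a set"
  assumes indep: "indep_vars (\<lambda>_. borel) (\<lambda>k. indicator (A k) :: 'a \<Rightarrow> real) UNIV"
    and event [measurable]: "\<And>k. A k \<in> events"
    and summable_prob: "summable (\<lambda>k. prob (A k))"
begin

definition occurrences :: "'a \<Rightarrow> real" where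
  "occurrences \<omega> = real (card {k. \<omega> \<in> A k})"

definition occurrences_below :: "nat \<Rightarrow> 'a \<Rightarrow> real" where
  "occurrences_below n \<omega> = (\<Sum>k<n. indicator (A k) \<omega>)"

lemma measurable_occurrences_below [measurable]: "occurrences_below n \<in> borel_measurable M"
  unfolding occurrences_below_def by measurable

lemma occurrences_below_bounds: "0 \<le> occurrences_below n \<omega>" "occurrences_below n \<omega> \<le> n"
proof -
  have "(\<Sum>k<n. indicator (A k) \<omega>) \<le> (\<Sum>k<n. 1::real)"
    by (intro sum_mono) (auto simp: indicator_def)
  then show "occurrences_below n \<omega> \<le> n"
    by (simp add: occurrences_below_def)
qed (auto simp: occurrences_below_def intro: sum_nonneg)

lemma mono_occurrences_below: "mono (\<lambda>n. occurrences_below n \<omega>)"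
  unfolding occurrences_below_def by (intro monoI sum_mono2) auto

lemma AE_finite_occurrences: "AE \<omega> in M. finite {k. \<omega> \<in> A k}"
proof -
  have "AE \<omega> in M. eventually (\<lambda>n. \<omega> \<in> space M - A n) sequentially"
    by (rule borel_cantelli_AE1) (auto simp: summable_prob emeasure_eq_measure)
  then show ?thesis
  proof eventually_elim
    case (elim \<omega>)
    then obtain N where N: "\<And>n. n \<ge> N \<Longrightarrow> \<omega> \<notin> A n"
      by (auto simp: eventually_sequentially)
    have "{k. \<omega> \<in> A k} \<subseteq> {..<N}"
      using N by (auto simp: not_le[symmetric])
    then show ?case
      by (rule finite_subset) simp
  qed
qed

lemma occurrences_below_tendsto:
  assumes "finite {k. \<omega> \<in> A k}"
  shows "(\<lambda>n. occurrences_below n \<omega>) \<longlonglongrightarrow> occurrences \<omega>"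
proof -
  obtain N where N: "{k. \<omega> \<in> A k} \<subseteq> {..<N}"
    using finite_nat_iff_bounded assms by blast
  have "occurrences_below n \<omega> = occurrences \<omega>" if "n \<ge> N" for n
  proof -
    have "{..<n} \<inter> {k. \<omega> \<in> A k} = {k. \<omega> \<in> A k}"
      using N that by auto
    then show ?thesis
      unfolding occurrences_below_def occurrences_def indicator_def
      by (simp add: sum.If_cases of_bool_def)
  qed
  then show ?thesis
    by (intro tendsto_eventually) (auto simp: eventually_sequentially)
qed

lemma AE_occurrences_below_tendsto:
  "AE \<omega> in M. (\<lambda>n. occurrences_below n \<omega>) \<longlonglongrightarrow> occurrences \<omega>"
  using AE_finite_occurrences by eventually_elim (rule occurrences_below_tendsto)

text \<open>
  Infinitely many occurrences are given the value zero by the cardinality, so the count is the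
  limit of the partial sums only off this (measurable) null set.
\<close>
lemma measurable_occurrences [measurable]: "occurrences \<in> borel_measurable M"
proof -
  have eq: "occurrences \<omega> = (if finite {k. \<omega> \<in> A k} then lim (\<lambda>n. occurrences_below n \<omega>) else 0)" for \<omega>
    using occurrences_below_tendsto[of \<omega>]
    by (auto simp: limI) (simp add: occurrences_def)
  have fin: "{\<omega> \<in> space M. finite {k. \<omega> \<in> A k}} \<in> sets M"
    unfolding finite_nat_set_iff_bounded Ball_def mem_Collect_eq by measurable
  show ?thesis
    unfolding eq by (rule measurable_If[OF _ _ fin]) measurable
qed

lemma summable_variance: "summable (\<lambda>k. prob (A k) * (1 - prob (A k)))"
  by (rule summable_comparison_test'[OF summable_prob])
     (auto intro!: mult_left_le simp: abs_mult)

lemma integrable_occurrences_below [simp]: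
  "integrable M (occurrences_below n)" "integrable M (\<lambda>\<omega>. (occurrences_below n \<omega>)\<^sup>2)"
proof -
  show "integrable M (occurrences_below n)"
    by (rule integrable_const_bound[of _ n]) (use occurrences_below_bounds in auto)
  show "integrable M (\<lambda>\<omega>. (occurrences_below n \<omega>)\<^sup>2)"
    by (rule integrable_const_bound[of _ "n^2"]) (use occurrences_below_bounds in \<open>auto intro!: power_mono\<close>)
qed

lemma expectation_occurrences_below: "expectation (occurrences_below n) = (\<Sum>k<n. prob (A k))"
  unfolding occurrences_below_def
  by (subst Bochner_Integration.integral_sum) (auto simp: emeasure_eq_measure)

definition centred :: "nat \<Rightarrow> 'a \<Rightarrow> real" where
  "centred k \<omega> = indicator (A k) \<omega> - prob (A k)"

lemma centred_bound: "\<bar>centred k \<omega>\<bar> \<le> 1"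
  using prob_le_1[of "A k"] measure_nonneg[of M "A k"]
  by (cases "\<omega> \<in> A k") (auto simp: centred_def abs_le_iff simp del: prob_le_1 measure_nonneg)

lemma measurable_centred [measurable]: "centred k \<in> borel_measurable M"
  unfolding centred_def by measurable

lemma integrable_centred [simp]: "integrable M (centred k)" "integrable M (\<lambda>\<omega>. (centred k \<omega>)\<^sup>2)"
proof -
  show "integrable M (centred k)"
    by (rule integrable_const_bound[of _ 1]) (use centred_bound in auto)
  show "integrable M (\<lambda>\<omega>. (centred k \<omega>)\<^sup>2)"
    by (rule integrable_const_bound[of _ 1]) (use centred_bound in \<open>auto simp: abs_square_le_1\<close>)
qed

lemma expectation_centred: "expectation (centred k) = 0"
  unfolding centred_def by (subst Bochner_Integration.integral_diff) (auto simp: prob_space emeasure_eq_measure)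

lemma second_moment_centred: "expectation (\<lambda>\<omega>. (centred k \<omega>)\<^sup>2) = prob (A k) * (1 - prob (A k))"
proof -
  have eq: "(centred k \<omega>)\<^sup>2 = (1 - 2 * prob (A k)) * indicator (A k) \<omega> + (prob (A k))\<^sup>2" for \<omega>
    by (auto simp: centred_def indicator_def power2_eq_square algebra_simps)
  show ?thesis
    unfolding eq by (simp add: emeasure_eq_measure prob_space power2_eq_square algebra_simps)
qed

lemma indep_centred: "indep_vars (\<lambda>_. borel) centred I"
proof -
  have "indep_vars (\<lambda>_. borel) (\<lambda>k \<omega>. (\<lambda>x. x - prob (A k)) (indicator (A k) \<omega> :: real)) I"
    by (rule indep_vars_compose2[OF indep_vars_subset[OF indep]]) auto
  then show ?thesis
    by (simp add: centred_def[abs_def])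
qed

lemma sum_centred: "(\<Sum>k<n. centred k \<omega>) = occurrences_below n \<omega> - (\<Sum>k<n. prob (A k))"
  by (simp add: centred_def occurrences_below_def sum_subtractf)

text \<open>
  The cross terms vanish: a centred indicator is independent of the sum of the earlier ones and has
  mean zero.
\<close>
lemma second_moment_sum_centred:
  "expectation (\<lambda>\<omega>. (\<Sum>k<n. centred k \<omega>)\<^sup>2) = (\<Sum>k<n. prob (A k) * (1 - prob (A k)))"
proof (induction n)
  case (Suc n)
  let ?S = "\<lambda>\<omega>. \<Sum>k<n. centred k \<omega>"
  have ind: "indep_var borel (centred n) borel ?S"
    by (rule indep_vars_sum) (auto intro: indep_centred)
  have int: "integrable M ?S" by auto
  have int2: "integrable M (\<lambda>\<omega>. (?S \<omega>)\<^sup>2)"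
    unfolding sum_centred power2_diff by auto
  have int_mult: "integrable M (\<lambda>\<omega>. centred n \<omega> * ?S \<omega>)"
    by (rule indep_var_integrable[OF ind]) (auto simp: int)
  have "expectation (\<lambda>\<omega>. centred n \<omega> * ?S \<omega>) = 0"
    using indep_var_lebesgue_integral[OF ind _ int] by (simp add: expectation_centred)
  then show ?case
    using Suc int_mult int2
    by (simp add: power2_sum second_moment_centred mult.assoc mult.commute[of "?S _"])
qed (simp)

lemma second_moment_occurrences_below:
  "expectation (\<lambda>\<omega>. (occurrences_below n \<omega>)\<^sup>2)
     = (\<Sum>k<n. prob (A k) * (1 - prob (A k))) + (\<Sum>k<n. prob (A k))\<^sup>2"
  using variance_eq[OF integrable_occurrences_below, of n] second_moment_sum_centred[of n]
  by (simp add: sum_centred expectation_occurrences_below)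

lemma
  shows integrable_occurrences: "integrable M occurrences"
    and expectation_occurrences: "expectation occurrences = (\<Sum>k. prob (A k))"
proof -
  have lim: "(\<lambda>n. expectation (occurrences_below n)) \<longlonglongrightarrow> (\<Sum>k. prob (A k))"
    unfolding expectation_occurrences_below by (rule summable_LIMSEQ[OF summable_prob])
  note conv = integrable_monotone_convergence integral_monotone_convergence
  note * = _ _ AE_occurrences_below_tendsto lim
  show "integrable M occurrences" "expectation occurrences = (\<Sum>k. prob (A k))"
    by (rule conv[OF *]; use mono_occurrences_below in simp)+
qed

lemma
  shows integrable_square_occurrences: "integrable M (\<lambda>\<omega>. (occurrences \<omega>)\<^sup>2)"
    and variance_occurrences: "variance occurrences = (\<Sum>k. prob (A k) * (1 - prob (A k)))"
proof -
  \<comment> \<open>The squared partial sums increase, so monotone convergence gives the second moment, and the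
    squared mean in it cancels in the variance.\<close>
  let ?L = "(\<Sum>k. prob (A k) * (1 - prob (A k))) + (\<Sum>k. prob (A k))\<^sup>2"
  have lim: "(\<lambda>n. expectation (\<lambda>\<omega>. (occurrences_below n \<omega>)\<^sup>2)) \<longlonglongrightarrow> ?L"
    unfolding second_moment_occurrences_below
    by (intro tendsto_intros summable_LIMSEQ summable_prob summable_variance)
  have conv: "AE \<omega> in M. (\<lambda>n. (occurrences_below n \<omega>)\<^sup>2) \<longlonglongrightarrow> (occurrences \<omega>)\<^sup>2"
    using AE_occurrences_below_tendsto by eventually_elim (rule tendsto_power)
  have mono: "AE \<omega> in M. mono (\<lambda>n. (occurrences_below n \<omega>)\<^sup>2)"
    using mono_occurrences_below occurrences_below_bounds
    by (auto simp: mono_def intro!: AE_I2 power_mono)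
  note * = integrable_monotone_convergence[OF integrable_occurrences_below(2) mono conv lim]
    integral_monotone_convergence[OF integrable_occurrences_below(2) mono conv lim]
  show int: "integrable M (\<lambda>\<omega>. (occurrences \<omega>)\<^sup>2)"
    by (rule *) measurable
  show "variance occurrences = (\<Sum>k. prob (A k) * (1 - prob (A k)))"
    unfolding variance_eq[OF integrable_occurrences int]
    using *(2) by (simp add: expectation_occurrences)
qed

text \<open>
  Both the characteristic function and the Gaussian factor \<open>exp (- v u\<^sup>2 / 2)\<close>, with \<open>v\<close> the variance, are close
  to the second-order polynomial \<open>1 - v u\<^sup>2 / 2\<close>. A centred indicator is bounded by 1, so its third
  absolute moment is at most \<open>v\<close>, and also \<open>v\<^sup>2 \<le> v\<close>. Hence the error is linear in \<open>v\<close>, and the errors of the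
  factors of a product add up to a multiple of the total variance.
\<close>
lemma char_centred_approx:
  "cmod (char (distr M borel (centred k)) u - complex_of_real (exp (- (prob (A k) * (1 - prob (A k)) * u\<^sup>2 / 2))))
     \<le> prob (A k) * (1 - prob (A k)) * (\<bar>u\<bar> ^ 3 / 6 + u ^ 4 / 8)"
proof -
  define v where "v = prob (A k) * (1 - prob (A k))"
  define x where "x = u\<^sup>2 * v / 2"
  have v: "0 \<le> v" "v \<le> 1"
    by (auto simp: v_def intro!: mult_le_one)
  have "cmod (char (distr M borel (centred k)) u - (1 - u\<^sup>2 * v / 2))
      \<le> (u\<^sup>2 / 6) * expectation (\<lambda>\<omega>. min (6 * (centred k \<omega>)\<^sup>2) (\<bar>u\<bar> * \<bar>centred k \<omega>\<bar> ^ 3))"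
    by (rule char_approx3') (auto simp: expectation_centred second_moment_centred v_def)
  also have "expectation (\<lambda>\<omega>. min (6 * (centred k \<omega>)\<^sup>2) (\<bar>u\<bar> * \<bar>centred k \<omega>\<bar> ^ 3))
      \<le> expectation (\<lambda>\<omega>. \<bar>u\<bar> * (centred k \<omega>)\<^sup>2)"
  proof (rule integral_mono)
    show "integrable M (\<lambda>\<omega>. min (6 * (centred k \<omega>)\<^sup>2) (\<bar>u\<bar> * \<bar>centred k \<omega>\<bar> ^ 3))"
      by (rule Bochner_Integration.integrable_bound[where f="\<lambda>\<omega>. 6 * (centred k \<omega>)\<^sup>2"])
         (auto intro!: AE_I2)
    fix \<omega>
    have "\<bar>centred k \<omega>\<bar> ^ 3 \<le> \<bar>centred k \<omega>\<bar> ^ 2"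
      by (rule power_decreasing) (auto simp: centred_bound)
    then show "min (6 * (centred k \<omega>)\<^sup>2) (\<bar>u\<bar> * \<bar>centred k \<omega>\<bar> ^ 3) \<le> \<bar>u\<bar> * (centred k \<omega>)\<^sup>2"
      by (intro min.coboundedI2 mult_left_mono) auto
  qed auto
  also have "\<dots> = \<bar>u\<bar> * v"
    by (simp add: second_moment_centred v_def)
  finally have 1: "cmod (char (distr M borel (centred k)) u - (1 - x)) \<le> (u\<^sup>2 / 6) * (\<bar>u\<bar> * v)"
    by (simp add: mult_left_mono x_def)
  have x0: "x \<ge> 0" using v by (simp add: x_def)
  \<comment> \<open>The difference of both sides vanishes at 0 and has a nonnegative derivative.\<close>
  have "exp (-x) \<le> 1 - x + x\<^sup>2 / 2"
  proof -
    have "DERIV (\<lambda>x. 1 - x + x\<^sup>2 / 2 - exp (-x)) y :> - 1 + y + exp (- y)" for y :: real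
      by (auto intro!: derivative_eq_intros)
    moreover have "- 1 + y + exp (- y) \<ge> 0" for y :: real
      using exp_ge_add_one_self[of "-y"] by simp
    ultimately have "(\<lambda>x. 1 - x + x\<^sup>2 / 2 - exp (-x)) 0 \<le> (\<lambda>x. 1 - x + x\<^sup>2 / 2 - exp (-x)) x"
      by (intro DERIV_nonneg_imp_nondecreasing[OF x0]) blast
    then show ?thesis by simp
  qed
  moreover have "1 - x \<le> exp (-x)"
    using exp_ge_add_one_self[of "-x"] by simp
  ultimately have "\<bar>(1 - x) - exp (-x)\<bar> \<le> x\<^sup>2 / 2"
    by simp
  also have "x\<^sup>2 / 2 = v\<^sup>2 * u ^ 4 / 8"
    by (simp add: x_def power_mult_distrib power_divide power4_eq_xxxx power2_eq_square)
  also have "\<dots> \<le> v * u ^ 4 / 8"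
    using v by (intro divide_right_mono mult_right_mono) (auto simp: power2_eq_square mult_left_le)
  finally have "cmod (complex_of_real (1 - x) - complex_of_real (exp (-x))) \<le> v * u ^ 4 / 8"
    unfolding of_real_diff[symmetric] norm_of_real .
  from norm_triangle_ineq[of "char (distr M borel (centred k)) u - (1 - x)"
      "complex_of_real (1 - x) - complex_of_real (exp (-x))"] this 1
  have "cmod (char (distr M borel (centred k)) u - complex_of_real (exp (-x)))
      \<le> (u\<^sup>2 / 6) * (\<bar>u\<bar> * v) + v * u ^ 4 / 8"
    by simp
  moreover have "\<bar>u\<bar> ^ 3 = u\<^sup>2 * \<bar>u\<bar>"
    by (simp add: power3_eq_cube power2_eq_square)
  then have "(u\<^sup>2 / 6) * (\<bar>u\<bar> * v) + v * u ^ 4 / 8 = v * (\<bar>u\<bar> ^ 3 / 6 + u ^ 4 / 8)"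
    by (simp add: algebra_simps)
  ultimately show ?thesis
    unfolding x_def v_def[symmetric] by (simp only: mult.commute)
qed

text \<open>
  For finite sums the characteristic functions multiply, and the distance of two products of
  numbers in the unit disc is at most the sum of the distances of the factors. Dominated convergence
  carries the bound over to the infinite sum. After rescaling by the standard deviation \<open>\<sigma>\<close>, i.e. with
  \<open>u = \<theta> / \<sigma>\<close>, the bound is of order \<open>1 / \<sigma>\<close>.
\<close>
lemma char_occurrences_approx:
  "cmod (char (distr M borel (\<lambda>\<omega>. occurrences \<omega> - expectation occurrences)) u
       - complex_of_real (exp (- (variance occurrences * u\<^sup>2 / 2))))
     \<le> variance occurrences * (\<bar>u\<bar> ^ 3 / 6 + u ^ 4 / 8)"
proof -
  define v where "v k = prob (A k) * (1 - prob (A k))" for k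
  define c where "c = \<bar>u\<bar> ^ 3 / 6 + u ^ 4 / 8"
  let ?\<phi> = "\<lambda>k. char (distr M borel (centred k)) u"
  have v0: "v k \<ge> 0" for k by (simp add: v_def)
  have finite_n: "cmod (expectation (\<lambda>\<omega>. iexp (u * (\<Sum>k<n. centred k \<omega>)))
        - complex_of_real (exp (- ((\<Sum>k<n. v k) * u\<^sup>2 / 2))))
      \<le> (\<Sum>k<n. v k) * c" for n
  proof -
    have "expectation (\<lambda>\<omega>. iexp (u * (\<Sum>k<n. centred k \<omega>)))
        = char (distr M borel (\<lambda>\<omega>. \<Sum>k<n. centred k \<omega>)) u"
      by (simp add: char_def integral_distr)
    also have "\<dots> = (\<Prod>k<n. ?\<phi> k)"
      by (rule char_distr_sum[OF indep_centred])
    finally have lhs: "expectation (\<lambda>\<omega>. iexp (u * (\<Sum>k<n. centred k \<omega>))) = (\<Prod>k<n. ?\<phi> k)" .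
    have rhs: "exp (- ((\<Sum>k<n. v k) * u\<^sup>2 / 2)) = (\<Prod>k<n. exp (- (v k * u\<^sup>2 / 2)))"
      by (simp add: exp_sum[symmetric] sum_negf sum_distrib_right sum_divide_distrib)
    have "cmod ((\<Prod>k<n. ?\<phi> k) - complex_of_real (\<Prod>k<n. exp (- (v k * u\<^sup>2 / 2))))
        \<le> (\<Sum>k<n. cmod (?\<phi> k - complex_of_real (exp (- (v k * u\<^sup>2 / 2)))))"
      unfolding of_real_prod
    proof (rule norm_prod_diff)
      fix k
      interpret D: real_distribution "distr M borel (centred k)"
        by (rule real_distribution_distr) measurable
      show "cmod (?\<phi> k) \<le> 1" by (rule D.cmod_char_le_1)
      show "cmod (complex_of_real (exp (- (v k * u\<^sup>2 / 2)))) \<le> 1"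
        using v0[of k] by simp
    qed
    also have "\<dots> \<le> (\<Sum>k<n. v k * c)"
      unfolding v_def c_def using char_centred_approx by (intro sum_mono)
    finally show ?thesis
      unfolding lhs rhs by (simp add: sum_distrib_right)
  qed
  have sum_v: "(\<lambda>n. \<Sum>k<n. v k) \<longlonglongrightarrow> variance occurrences"
    unfolding variance_occurrences v_def by (rule summable_LIMSEQ[OF summable_variance])
  have "(\<lambda>n. expectation (\<lambda>\<omega>. iexp (u * (\<Sum>k<n. centred k \<omega>))))
      \<longlonglongrightarrow> expectation (\<lambda>\<omega>. iexp (u * (occurrences \<omega> - expectation occurrences)))"
  proof (rule integral_dominated_convergence[where w="\<lambda>_. 1"])
    have "(\<lambda>n. \<Sum>k<n. prob (A k)) \<longlonglongrightarrow> expectation occurrences"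
      unfolding expectation_occurrences by (rule summable_LIMSEQ[OF summable_prob])
    note mean = this
    show "AE \<omega> in M. (\<lambda>n. iexp (u * (\<Sum>k<n. centred k \<omega>)))
        \<longlonglongrightarrow> iexp (u * (occurrences \<omega> - expectation occurrences))"
      using AE_occurrences_below_tendsto unfolding sum_centred
    proof eventually_elim
      case (elim \<omega>)
      show ?case
        by (intro tendsto_intros elim mean)
    qed
  qed auto
  then have "(\<lambda>n. cmod (expectation (\<lambda>\<omega>. iexp (u * (\<Sum>k<n. centred k \<omega>)))
        - complex_of_real (exp (- ((\<Sum>k<n. v k) * u\<^sup>2 / 2)))))
      \<longlonglongrightarrow> cmod (expectation (\<lambda>\<omega>. iexp (u * (occurrences \<omega> - expectation occurrences)))
        - complex_of_real (exp (- (variance occurrences * u\<^sup>2 / 2))))"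
    by (intro tendsto_intros sum_v) auto
  moreover have "(\<lambda>n. (\<Sum>k<n. v k) * c) \<longlonglongrightarrow> variance occurrences * c"
    by (intro tendsto_intros sum_v)
  ultimately have "cmod (expectation (\<lambda>\<omega>. iexp (u * (occurrences \<omega> - expectation occurrences)))
        - complex_of_real (exp (- (variance occurrences * u\<^sup>2 / 2)))) \<le> variance occurrences * c"
    by (rule LIMSEQ_le) (use finite_n in blast)
  then show ?thesis
    by (simp add: char_def integral_distr c_def)
qed

end

text \<open>
  Since indicators are bounded, divergence of the variance is the only condition: the error of the
  Gaussian approximation of the characteristic functions tends to zero, and Levy's continuity
  theorem applies. The events may change completely from one \<open>n\<close> to the next.
\<close>
lemma (in prob_space) clt_occurrences:
  fixes A :: "nat \<Rightarrow> nat \<Rightarrow> 'a set"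
  assumes fam: "\<And>n. indep_event_family M (A n)"
  defines "N \<equiv> \<lambda>n \<omega>. real (card {k. \<omega> \<in> A n k})"
  assumes var: "filterlim (\<lambda>n. variance (N n)) at_top sequentially"
  shows "weak_conv_m (\<lambda>n. distr M borel (\<lambda>\<omega>. (N n \<omega> - expectation (N n)) / sqrt (variance (N n))))
    std_normal_distribution"
proof (rule levy_continuity)
  have N: "N n = indep_event_family.occurrences (A n)" for n
    by (simp add: N_def fun_eq_iff indep_event_family.occurrences_def[OF fam])
  have [measurable]: "N n \<in> borel_measurable M" for n
    unfolding N by (rule indep_event_family.measurable_occurrences[OF fam])
  show "real_distribution (distr M borel (\<lambda>\<omega>. (N n \<omega> - expectation (N n)) / sqrt (variance (N n))))" for n
    by (rule real_distribution_distr) measurable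
  show "real_distribution std_normal_distribution"
    by (rule real_dist_normal_dist)
  fix \<theta> :: real
  define \<sigma> where "\<sigma> n = sqrt (variance (N n))" for n
  have \<sigma>: "filterlim \<sigma> at_top sequentially"
    unfolding \<sigma>_def using filterlim_compose[OF sqrt_at_top var] .
  let ?\<phi> = "\<lambda>n. char (distr M borel (\<lambda>\<omega>. (N n \<omega> - expectation (N n)) / \<sigma> n)) \<theta>"
  have "\<forall>\<^sub>F n in sequentially. cmod (?\<phi> n - complex_of_real (exp (- (\<theta>\<^sup>2 / 2))))
      \<le> \<bar>\<theta>\<bar> ^ 3 / 6 * inverse (\<sigma> n) + \<theta> ^ 4 / 8 * (inverse (\<sigma> n))\<^sup>2"
    using filterlim_at_top_dense[THEN iffD1, rule_format, OF \<sigma>, of 0]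
  proof eventually_elim
    case (elim n)
    have var_eq: "variance (N n) = (\<sigma> n)\<^sup>2"
      unfolding \<sigma>_def using variance_positive[of "N n"] by simp
    have "?\<phi> n = char (distr M borel (\<lambda>\<omega>. N n \<omega> - expectation (N n))) (\<theta> / \<sigma> n)"
      by (simp add: char_def integral_distr)
    then have "cmod (?\<phi> n - complex_of_real (exp (- ((\<sigma> n)\<^sup>2 * (\<theta> / \<sigma> n)\<^sup>2 / 2))))
        \<le> (\<sigma> n)\<^sup>2 * (\<bar>\<theta> / \<sigma> n\<bar> ^ 3 / 6 + (\<theta> / \<sigma> n) ^ 4 / 8)"
      using indep_event_family.char_occurrences_approx[OF fam, of n "\<theta> / \<sigma> n"]
      unfolding N[symmetric] var_eq by simp
    also have "(\<sigma> n)\<^sup>2 * (\<theta> / \<sigma> n)\<^sup>2 = \<theta>\<^sup>2"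
      using elim by (simp add: power_divide)
    also have "(\<sigma> n)\<^sup>2 * (\<bar>\<theta> / \<sigma> n\<bar> ^ 3 / 6 + (\<theta> / \<sigma> n) ^ 4 / 8)
        = \<bar>\<theta>\<bar> ^ 3 / 6 * inverse (\<sigma> n) + \<theta> ^ 4 / 8 * (inverse (\<sigma> n))\<^sup>2"
      using elim by (simp add: field_simps power2_eq_square power3_eq_cube power4_eq_xxxx)
    finally show ?case .
  qed
  note bound = this
  have "(\<lambda>n. \<bar>\<theta>\<bar> ^ 3 / 6 * inverse (\<sigma> n) + \<theta> ^ 4 / 8 * (inverse (\<sigma> n))\<^sup>2)
      \<longlonglongrightarrow> \<bar>\<theta>\<bar> ^ 3 / 6 * 0 + \<theta> ^ 4 / 8 * 0\<^sup>2"
    by (intro tendsto_intros tendsto_inverse_0_at_top \<sigma>)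
  then have "(\<lambda>n. \<bar>\<theta>\<bar> ^ 3 / 6 * inverse (\<sigma> n) + \<theta> ^ 4 / 8 * (inverse (\<sigma> n))\<^sup>2) \<longlonglongrightarrow> 0"
    by simp
  from Lim_null_comparison[OF bound this]
  have "?\<phi> \<longlonglongrightarrow> complex_of_real (exp (- (\<theta>\<^sup>2 / 2)))"
    by (simp only: LIM_zero_iff)
  then show "(\<lambda>n. char (distr M borel (\<lambda>\<omega>. (N n \<omega> - expectation (N n)) / sqrt (variance (N n)))) \<theta>)
      \<longlonglongrightarrow> char std_normal_distribution \<theta>"
    by (simp add: \<sigma>_def char_std_normal_distribution)
qed

section \<open>The law of a single bit\<close>

text \<open>
  The probability that a bit of rate \<open>r\<close> is active at time \<open>t\<close>, as a function of \<open>x = r * t\<close>.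
\<close>
definition bf_prob :: "real \<Rightarrow> real" where "bf_prob x = (1 - exp (- 2 * x)) / 2"
definition db_prob :: "real \<Rightarrow> real" where "db_prob x = x * exp (- x)"

text \<open>
  The mean of \<open>(-1)\<^sup>n\<close> is the probability of an even value minus that of an odd value, and the exponential
  series evaluates it to \<open>exp (- 2 * r)\<close>.
\<close>
lemma prob_odd_poisson:
  assumes "r > 0"
  shows "measure (measure_pmf (poisson_pmf r)) {n. odd n} = (1 - exp (- 2 * r)) / 2"
proof -
  let ?P = "measure_pmf (poisson_pmf r)"
  let ?f = "\<lambda>n. pmf (poisson_pmf r) n * (-1) ^ n"
  have abs: "integrable (count_space UNIV) ?f"
  proof (rule Bochner_Integration.integrable_bound[where f="pmf (poisson_pmf r)"])
    show "integrable (count_space UNIV) (pmf (poisson_pmf r))"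
      by (simp add: integrable_pmf)
  qed (auto simp: abs_mult)
  have "?f sums measure_pmf.expectation (poisson_pmf r) (\<lambda>n. (-1) ^ n)"
    using sums_integral_count_space_nat[OF abs]
    by (simp add: measure_pmf_eq_density integral_density)
  moreover have "?f sums (exp (- r) * exp (- r))"
    using sums_mult[OF exp_converges[of "- r"], of "exp (- r)"] assms
    by (simp add: field_simps power_minus[of r])
  ultimately have "measure_pmf.expectation (poisson_pmf r) (\<lambda>n. (-1) ^ n) = exp (- r) * exp (- r)"
    by (rule sums_unique2)
  also have "(\<lambda>n. (-1) ^ n :: real) = (\<lambda>n. 1 - 2 * indicator {n. odd n} n)"
    by (auto simp: fun_eq_iff indicator_def uminus_power_if)
  also have "measure_pmf.expectation (poisson_pmf r) (\<lambda>n. 1 - 2 * indicator {n. odd n} n)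
      = 1 - 2 * measure ?P {n. odd n}"
    by (subst Bochner_Integration.integral_diff)
       (auto simp: measure_pmf.emeasure_eq_measure intro!: integrable_real_indicator)
  finally show ?thesis
    by (simp add: mult_exp_exp)
qed

lemma active_event_bf:
  assumes "bf_bit M r X" "t \<ge> 0"
  shows "{\<omega> \<in> space M. X t \<omega> = 1} \<in> sets M"
  using assms measurable_sets[of "X t" M "count_space {0, 1}" "{1}"]
  by (simp add: bf_bit_def vimage_def Int_def conj_commute)

lemma (in prob_space) prob_bf_bit_active:
  assumes X: "bf_bit M r X" and r: "r > 0" and t: "t > 0"
  shows "prob {\<omega> \<in> space M. X t \<omega> = 1} = bf_prob (r * t)"
proof -
  obtain N where N: "poisson_process M r N" and XN: "AE \<omega> in M. \<forall>t\<ge>0. X t \<omega> = N t \<omega> mod 2"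
    and [measurable]: "X t \<in> M \<rightarrow>\<^sub>M count_space {0, 1}"
    using X t unfolding bf_bit_def by auto
  have [measurable]: "N t \<in> M \<rightarrow>\<^sub>M count_space UNIV" "N 0 \<in> M \<rightarrow>\<^sub>M count_space UNIV"
    using N t unfolding poisson_process_def by auto
  have X_meas: "{\<omega> \<in> space M. X t \<omega> = 1} \<in> events"
    by (rule active_event_bf[OF X]) (use t in simp)
  have N0: "AE \<omega> in M. N 0 \<omega> = 0"
    using N unfolding poisson_process_def by auto
  have distr: "distr M (count_space UNIV) (\<lambda>\<omega>. N t \<omega> - N 0 \<omega>) = measure_pmf (poisson_pmf (r * t))"
    using N t unfolding poisson_process_def by force
  have "prob {\<omega> \<in> space M. X t \<omega> = 1} = prob ((\<lambda>\<omega>. N t \<omega> - N 0 \<omega>) -` {n. odd n} \<inter> space M)"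
  proof (rule measure_eq_AE)
    show "AE \<omega> in M. \<omega> \<in> {\<omega> \<in> space M. X t \<omega> = 1} \<longleftrightarrow>
        \<omega> \<in> (\<lambda>\<omega>. N t \<omega> - N 0 \<omega>) -` {n. odd n} \<inter> space M"
      using XN N0 AE_space by eventually_elim (use t in \<open>simp add: odd_iff_mod_2_eq_one\<close>)
  qed (use X_meas in measurable)
  also have "\<dots> = measure (distr M (count_space UNIV) (\<lambda>\<omega>. N t \<omega> - N 0 \<omega>)) {n. odd n}"
    by (subst measure_distr) auto
  also have "\<dots> = bf_prob (r * t)"
    unfolding distr bf_prob_def by (subst prob_odd_poisson) (use r t in \<open>auto simp: algebra_simps\<close>)
  finally show ?thesis .
qed

lemma active_event_db:
  assumes "db_bit M r X" "t \<ge> 0"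
  shows "{\<omega> \<in> space M. X t \<omega> = 1} \<in> sets M"
  using assms measurable_sets[of "X t" M "count_space {0, 1, 2}" "{1}"]
  by (simp add: db_bit_def vimage_def Int_def conj_commute)

text \<open>
  A bit is active between its first and its second change. These times have exponential and Erlang
  distributions, and the first one precedes the second one almost surely, so the probability is
  the difference of the two tail probabilities.
\<close>
lemma (in prob_space) prob_db_bit_active:
  assumes X: "db_bit M r X" and r: "r > 0" and t: "t > 0"
  shows "prob {\<omega> \<in> space M. X t \<omega> = 1} = db_prob (r * t)"
proof -
  obtain U V where U: "distributed M lborel U (exponential_density r)"
    and V: "distributed M lborel V (exponential_density r)"
    and UV: "indep_var borel U borel V"
    and XUV: "AE \<omega> in M. \<forall>t\<ge>0. X t \<omega> =
               (if t < U \<omega> then 0 else if t < U \<omega> + V \<omega> then 1 else 2)"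
    and [measurable]: "X t \<in> M \<rightarrow>\<^sub>M count_space {0, 1, 2}"
    using X t unfolding db_bit_def by auto
  have [measurable]: "U \<in> borel_measurable M" "V \<in> borel_measurable M"
    using distributed_measurable[OF U] distributed_measurable[OF V] by auto
  have X_meas: "{\<omega> \<in> space M. X t \<omega> = 1} \<in> events"
    by (rule active_event_db[OF X]) (use t in simp)
  have sum: "distributed M lborel (\<lambda>\<omega>. U \<omega> + V \<omega>) (erlang_density (Suc 0) r)"
    using sum_indep_erlang[OF UV r U V] by simp
  have "prob {\<omega> \<in> space M. 0 < V \<omega>} = 1"
    using exponential_distributedD_gt[OF V _ r, of 0] by simp
  then have V_pos: "AE \<omega> in M. 0 < V \<omega>"
    by (subst (asm) prob_Collect_eq_1) auto
  have "prob {\<omega> \<in> space M. X t \<omega> = 1}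
      = prob ({\<omega> \<in> space M. t < U \<omega> + V \<omega>} - {\<omega> \<in> space M. t < U \<omega>} \<inter> {\<omega> \<in> space M. t < U \<omega> + V \<omega>})"
  proof (intro measure_eq_AE)
    show "AE \<omega> in M. \<omega> \<in> {\<omega> \<in> space M. X t \<omega> = 1} \<longleftrightarrow>
        \<omega> \<in> {\<omega> \<in> space M. t < U \<omega> + V \<omega>}
          - {\<omega> \<in> space M. t < U \<omega>} \<inter> {\<omega> \<in> space M. t < U \<omega> + V \<omega>}"
      using XUV V_pos by eventually_elim (use t in auto)
  qed (use X_meas in auto)
  also have "\<dots> = prob {\<omega> \<in> space M. t < U \<omega> + V \<omega>}
      - prob ({\<omega> \<in> space M. t < U \<omega>} \<inter> {\<omega> \<in> space M. t < U \<omega> + V \<omega>})"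
    by (rule finite_measure_Diff) auto
  also have "prob ({\<omega> \<in> space M. t < U \<omega>} \<inter> {\<omega> \<in> space M. t < U \<omega> + V \<omega>}) = prob {\<omega> \<in> space M. t < U \<omega>}"
    using V_pos by (intro measure_eq_AE) auto
  also have "prob {\<omega> \<in> space M. t < U \<omega>} = exp (- t * r)"
    using exponential_distributedD_gt[OF U _ r] t by simp
  also have "prob {\<omega> \<in> space M. t < U \<omega> + V \<omega>} = exp (- r * t) + r * t * exp (- r * t)"
    using erlang_distributed_gt[OF sum r, of t] t by (simp add: erlang_CDF_def)
  finally show ?thesis
    by (simp add: db_prob_def mult.commute)
qed

lemma bf_prob_bounds: "x \<ge> 0 \<Longrightarrow> bf_prob x \<le> x" "bf_prob x \<le> 1 / 2"
  using exp_ge_add_one_self[of "- 2 * x"] by (auto simp: bf_prob_def)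

text \<open>
  The sharp bound is \<open>exp (- 1)\<close>, but 1/2 serves both models and follows from the quadratic Taylor bound.
\<close>
lemma db_prob_bounds: assumes "x \<ge> 0" shows "db_prob x \<le> x" "db_prob x \<le> 1 / 2"
proof -
  show "db_prob x \<le> x"
    using assms by (simp add: db_prob_def mult_left_le)
  have "2 * x \<le> exp x"
  proof -
    have "2 * x \<le> 1 + x + x\<^sup>2 / 2"
      using zero_le_power2[of "x - 1"] by (simp add: power2_diff)
    also have "\<dots> \<le> exp x"
      using exp_lower_Taylor_quadratic[OF assms] by simp
    finally show ?thesis .
  qed
  then show "db_prob x \<le> 1 / 2"
    by (simp add: db_prob_def exp_minus field_simps)
qed

text \<open>
  The state of a bit at time \<open>t\<close> is a measurable function of its path, namely a coordinate projection.
  The bits are numbered from 1 and the events from 0, whence the reindexing along \<^const>\<open>Suc\<close>.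
\<close>
lemma (in prob_space) indep_active_indicators:
  assumes indep: "indep_processes M S \<zeta>" and S: "1 \<in> S" and t: "t \<ge> 0"
  shows "indep_vars (\<lambda>_. borel)
    (\<lambda>k. indicator {\<omega> \<in> space M. \<zeta> (Suc k) t \<omega> = 1} :: 'a \<Rightarrow> real) UNIV"
proof -
  have "(\<lambda>x. indicator {1} (x t) :: real) \<in> borel_measurable (PiM {0..} (\<lambda>_. count_space S))"
    by (rule measurable_compose[OF measurable_component_singleton]) (use t in auto)
  note meas = this
  have "range Suc = {1..}"
    by (auto simp: image_iff Suc_le_eq gr0_conv_Suc)
  then have "indep_vars (\<lambda>_. PiM {0..} (\<lambda>_. count_space S)) (\<lambda>k \<omega>. \<lambda>t\<in>{0..}. \<zeta> k t \<omega>) (range Suc)"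
    using indep unfolding indep_processes_def by simp
  then have "indep_vars (\<lambda>_. borel)
      (\<lambda>k \<omega>. indicator {1} ((\<lambda>s\<in>{0..}. \<zeta> k s \<omega>) t) :: real) (range Suc)"
    by (rule indep_vars_compose2[where Y="\<lambda>_ x. indicator {1} (x t)"]) (rule meas)
  from indep_vars_reindex_inj[OF inj_Suc this]
  show ?thesis
    by (rule indep_vars_cong_space) (use t in \<open>auto simp: indicator_def\<close>)
qed

section \<open>The number of active bits\<close>

lemma summable_pmf_nat: "summable (pmf P :: nat \<Rightarrow> real)"
proof -
  have "integrable (count_space UNIV) (pmf P)"
    by (rule integrable_pmf)
  from sums_integral_count_space_nat[OF this] show ?thesis
    by (rule sums_summable)
qed

text \<open>
  What the two models have in common: at each fixed time the bits are active independently of each other, with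
  probabilities \<open>f (p k * t)\<close> where \<open>f\<close> is at most linear, so that these probabilities are summable, and
  at most 1/2, so that each bit contributes to the variance at least half of what it contributes to
  the mean. Here \<open>p k\<close> is the rate of bit \<open>Suc k\<close>.
\<close>
locale bit_model = prob_space +
  fixes p :: "nat \<Rightarrow> real" and f :: "real \<Rightarrow> real" and \<zeta> :: "nat \<Rightarrow> real \<Rightarrow> 'a \<Rightarrow> nat"
  assumes rate_pos: "\<And>k. p k > 0" and summable_rate: "summable p"
    and f_le: "\<And>x. x \<ge> 0 \<Longrightarrow> f x \<le> x" and f_le_half: "\<And>x. x \<ge> 0 \<Longrightarrow> f x \<le> 1 / 2"
    and active_event: "\<And>k t. t > 0 \<Longrightarrow> {\<omega> \<in> space M. \<zeta> (Suc k) t \<omega> = 1} \<in> events"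
    and prob_active: "\<And>k t. t > 0 \<Longrightarrow> prob {\<omega> \<in> space M. \<zeta> (Suc k) t \<omega> = 1} = f (p k * t)"
    and indep_active: "\<And>t. t > 0 \<Longrightarrow> indep_vars (\<lambda>_. borel)
          (\<lambda>k. indicator {\<omega> \<in> space M. \<zeta> (Suc k) t \<omega> = 1} :: 'a \<Rightarrow> real) UNIV"
begin

abbreviation active :: "real \<Rightarrow> nat \<Rightarrow> 'a set" where
  "active t k \<equiv> {\<omega> \<in> space M. \<zeta> (Suc k) t \<omega> = 1}"

lemma f_nonneg: "t > 0 \<Longrightarrow> 0 \<le> f (p k * t)"
  using prob_active[of t k] by (metis measure_nonneg)

lemma summable_prob_active: assumes "t > 0" shows "summable (\<lambda>k. f (p k * t))"
proof (rule summable_comparison_test')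
  show "summable (\<lambda>k. p k * t)"
    by (rule summable_mult2[OF summable_rate])
  show "norm (f (p k * t)) \<le> p k * t" for k
    using f_nonneg[OF assms] f_le[of "p k * t"] assms rate_pos[of k] by simp
qed

lemma indep_event_family_active: assumes "t > 0" shows "indep_event_family M (active t)"
proof unfold_locales
  show "summable (\<lambda>k. prob (active t k))"
    unfolding prob_active[OF assms] by (rule summable_prob_active[OF assms])
qed (use indep_active active_event assms in auto)

lemma active_bits_eq_occurrences:
  assumes "\<omega> \<in> space M"
  shows "active_bits \<zeta> t \<omega> = real (card {k. \<omega> \<in> active t k})"
proof -
  have "{k. 1 \<le> k \<and> \<zeta> k t \<omega> = 1} = Suc ` {k. \<zeta> (Suc k) t \<omega> = 1}"
    by (auto simp: image_iff Suc_le_eq gr0_conv_Suc)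
  then show ?thesis
    using assms by (simp add: active_bits_def card_image)
qed

lemma
  assumes "t > 0"
  shows expectation_active_bits: "expectation (active_bits \<zeta> t) = (\<Sum>k. f (p k * t))"
    and variance_active_bits: "variance (active_bits \<zeta> t) = (\<Sum>k. f (p k * t) * (1 - f (p k * t)))"
proof -
  interpret indep_event_family M "active t"
    by (rule indep_event_family_active[OF assms])
  have eq: "active_bits \<zeta> t \<omega> = occurrences \<omega>" if "\<omega> \<in> space M" for \<omega>
    using active_bits_eq_occurrences[OF that] unfolding occurrences_def .
  then have E: "expectation (active_bits \<zeta> t) = expectation occurrences"
    by (rule Bochner_Integration.integral_cong[OF refl])
  have V: "variance (active_bits \<zeta> t) = variance occurrences"
    by (rule Bochner_Integration.integral_cong[OF refl]) (simp only: eq E)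
  show "expectation (active_bits \<zeta> t) = (\<Sum>k. f (p k * t))"
    unfolding E expectation_occurrences prob_active[OF assms] ..
  show "variance (active_bits \<zeta> t) = (\<Sum>k. f (p k * t) * (1 - f (p k * t)))"
    unfolding V variance_occurrences prob_active[OF assms] ..
qed

lemma variance_ge_half_expectation:
  assumes "t > 0"
  shows "variance (active_bits \<zeta> t) \<ge> expectation (active_bits \<zeta> t) / 2"
proof -
  interpret indep_event_family M "active t"
    by (rule indep_event_family_active[OF assms])
  have sum: "summable (\<lambda>k. f (p k * t) * (1 - f (p k * t)))"
    using summable_variance unfolding prob_active[OF assms] .
  have "f (p k * t) / 2 \<le> f (p k * t) * (1 - f (p k * t))" for k
    using mult_left_mono[OF _ f_nonneg[OF assms], of "1/2" "1 - f (p k * t)" k]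
      f_le_half[of "p k * t"] rate_pos[of k] assms by simp
  then have "(\<Sum>k. f (p k * t) / 2) \<le> (\<Sum>k. f (p k * t) * (1 - f (p k * t)))"
    by (intro suminf_le summable_divide summable_prob_active assms sum)
  then show ?thesis
    unfolding variance_active_bits[OF assms] unfolding expectation_active_bits[OF assms]
    by (simp add: suminf_divide summable_prob_active assms)
qed

lemma filterlim_variance:
  assumes "filterlim (\<lambda>t. expectation (active_bits \<zeta> t)) at_top at_top"
  shows "filterlim (\<lambda>t. variance (active_bits \<zeta> t)) at_top at_top"
proof (rule filterlim_at_top_mono)
  show "filterlim (\<lambda>t. expectation (active_bits \<zeta> t) / 2) at_top at_top"
    using filterlim_tendsto_pos_mult_at_top[OF tendsto_const _ assms, of "1/2"] by simp
  show "\<forall>\<^sub>F t in at_top. expectation (active_bits \<zeta> t) / 2 \<le> variance (active_bits \<zeta> t)"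
    using eventually_gt_at_top[of 0] by eventually_elim (rule variance_ge_half_expectation)
qed

theorem clt_active_bits:
  assumes var: "filterlim (\<lambda>t. variance (active_bits \<zeta> t)) at_top at_top"
  shows "weak_conv_along at_top
    (\<lambda>t. distr M borel (\<lambda>\<omega>. (active_bits \<zeta> t \<omega> - expectation (active_bits \<zeta> t)) /
           sqrt (variance (active_bits \<zeta> t)))) std_normal_distribution"
  unfolding weak_conv_along_def
proof (intro allI impI tendsto_at_topI_sequentially)
  fix x and T :: "nat \<Rightarrow> real"
  assume x: "isCont (cdf std_normal_distribution) x" and T: "filterlim T at_top sequentially"
  define \<mu> where "\<mu> t = distr M borel (\<lambda>\<omega>. (active_bits \<zeta> t \<omega> - expectation (active_bits \<zeta> t)) /
           sqrt (variance (active_bits \<zeta> t)))" for t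
  \<comment> \<open>Positive times are needed for every index, not just eventually; the limit does not
    change when finitely many times are replaced.\<close>
  define T' where "T' n = max (T n) 1" for n
  have T'_pos: "T' n > 0" for n by (simp add: T'_def)
  have ev: "\<forall>\<^sub>F n in sequentially. T' n = T n"
    using filterlim_at_top[THEN iffD1, rule_format, OF T, of 1]
    by eventually_elim (simp add: T'_def)
  have T': "filterlim T' at_top sequentially"
    by (rule filterlim_at_top_mono[OF T]) (simp add: T'_def)
  define N where "N n \<omega> = real (card {k. \<omega> \<in> active (T' n) k})" for n \<omega>
  have eq: "active_bits \<zeta> (T' n) \<omega> = N n \<omega>" if "\<omega> \<in> space M" for n \<omega>
    using active_bits_eq_occurrences[OF that] by (simp add: N_def)
  then have E: "expectation (active_bits \<zeta> (T' n)) = expectation (N n)" for n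
    by (rule Bochner_Integration.integral_cong[OF refl])
  have V: "variance (active_bits \<zeta> (T' n)) = variance (N n)" for n
    by (rule Bochner_Integration.integral_cong[OF refl]) (simp only: eq E)
  have \<mu>: "\<mu> (T' n) = distr M borel (\<lambda>\<omega>. (N n \<omega> - expectation (N n)) / sqrt (variance (N n)))" for n
    unfolding \<mu>_def V unfolding E by (rule distr_cong) (simp_all only: eq)
  have "weak_conv_m (\<lambda>n. \<mu> (T' n)) std_normal_distribution"
    using filterlim_compose[OF var T'] unfolding \<mu> V unfolding N_def
    by (intro clt_occurrences indep_event_family_active T'_pos)
  then have "(\<lambda>n. cdf (\<mu> (T' n)) x) \<longlonglongrightarrow> cdf std_normal_distribution x"
    using x unfolding weak_conv_m_def weak_conv_def by blast
  then show "(\<lambda>n. cdf (\<mu> (T n)) x) \<longlonglongrightarrow> cdf std_normal_distribution x"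
    by (rule Lim_transform_eventually) (use ev in eventually_elim, simp)
qed

lemma expectation_ge_partial:
  assumes "t > 0" "finite K"
  shows "(\<Sum>k\<in>K. f (p k * t)) \<le> expectation (active_bits \<zeta> t)"
  unfolding expectation_active_bits[OF assms(1)]
  by (rule sum_le_suminf) (use assms f_nonneg summable_prob_active in auto)

end

section \<open>Growth of the mean\<close>

text \<open>
  In the flipping model every bit is active with probability tending to 1/2, and there are
  infinitely many bits: eventually each of any \<open>K\<close> given bits contributes at least 1/4 to the mean.
\<close>
lemma (in bit_model) expectation_at_top_bf:
  assumes f: "f = bf_prob"
  shows "filterlim (\<lambda>t. expectation (active_bits \<zeta> t)) at_top at_top"
  unfolding filterlim_at_top
proof
  fix Z :: real
  define K where "K = nat \<lceil>4 * Z\<rceil>"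
  have "\<forall>\<^sub>F t in at_top. \<forall>k\<in>{..<K}. 1 / 4 \<le> f (p k * t)"
  proof (intro eventually_ball_finite ballI)
    fix k
    have "\<forall>\<^sub>F t in at_top. 1 \<le> t * p k"
      using rate_pos[of k] eventually_ge_at_top[of "1 / p k"] by (simp add: field_simps)
    then show "\<forall>\<^sub>F t in at_top. 1 / 4 \<le> f (p k * t)"
    proof eventually_elim
      case (elim t)
      have "2 \<le> exp (2 * (p k * t))"
        using exp_ge_add_one_self[of "2 * (p k * t)"] elim unfolding mult.commute[of t] by linarith
      then have "exp (- 2 * (p k * t)) \<le> 1 / 2"
        by (simp add: exp_minus field_simps)
      then show ?case
        by (simp add: f bf_prob_def)
    qed
  qed simp
  then show "\<forall>\<^sub>F t in at_top. Z \<le> expectation (active_bits \<zeta> t)"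
    using eventually_gt_at_top[of 0]
  proof eventually_elim
    case (elim t)
    have "Z \<le> real K * (1 / 4)"
      unfolding K_def by linarith
    also have "\<dots> = (\<Sum>k<K. 1 / 4)" by simp
    also have "\<dots> \<le> (\<Sum>k<K. f (p k * t))"
      using elim by (intro sum_mono) auto
    also have "\<dots> \<le> expectation (active_bits \<zeta> t)"
      using elim by (intro expectation_ge_partial) auto
    finally show ?case .
  qed
qed

lemma ratio_shift_tendsto_1:
  fixes p :: "nat \<Rightarrow> real"
  assumes pos: "\<And>k. p k > 0" and ratio: "(\<lambda>k. p (Suc k) / p k) \<longlonglongrightarrow> 1"
  shows "(\<lambda>k. p (k + j) / p k) \<longlonglongrightarrow> 1"
proof (induction j)
  case 0
  then show ?case using pos by (simp add: less_imp_neq[symmetric])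
next
  case (Suc j)
  have "(\<lambda>k. p (Suc (k + j)) / p (k + j)) \<longlonglongrightarrow> 1"
    using LIMSEQ_ignore_initial_segment[OF ratio, of j] by simp
  from tendsto_mult[OF this Suc.IH] show ?case
    using pos by (simp add: less_imp_neq[symmetric])
qed

text \<open>
  In the damaging model a bit contributes substantially only while \<open>p k * t\<close> is of order 1. When the
  ratios of consecutive rates tend to 1, the rates vary so slowly that this holds for arbitrarily many bits at once:
  if \<open>m\<close> is the first index with \<open>p m * t \<le> 1\<close>, then for large \<open>t\<close> each of the \<open>J\<close> bits from \<open>m\<close> on has
  \<open>p k * t\<close> between 1/2 and 1, hence contributes at least \<open>exp (- 1) / 2\<close>.
\<close>
lemma (in bit_model) expectation_at_top_db:
  assumes f: "f = db_prob" and dec: "decseq p" and ratio: "(\<lambda>k. p (Suc k) / p k) \<longlonglongrightarrow> 1"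
  shows "filterlim (\<lambda>t. expectation (active_bits \<zeta> t)) at_top at_top"
  unfolding filterlim_at_top
proof
  fix Z :: real
  define J where "J = nat \<lceil>Z * (2 * exp 1)\<rceil>"
  have p0: "p \<longlonglongrightarrow> 0"
    by (rule summable_LIMSEQ_zero[OF summable_rate])
  have "\<forall>\<^sub>F k in sequentially. p (k + Suc J) / p k > 1 / 2"
    by (rule order_tendstoD[OF ratio_shift_tendsto_1[OF rate_pos ratio]]) simp
  then obtain K where K: "\<And>k. k \<ge> K \<Longrightarrow> p (k + Suc J) / p k > 1 / 2"
    by (auto simp: eventually_sequentially)
  \<comment> \<open>This puts the first index \<open>m\<close> beyond \<open>K\<close>, so that its predecessor \<open>l\<close> is at least \<open>K\<close>.\<close>
  have "\<forall>\<^sub>F t in at_top. t * p K > 1"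
    using rate_pos[of K] eventually_gt_at_top[of "1 / p K"] by (simp add: field_simps)
  then show "\<forall>\<^sub>F t in at_top. Z \<le> expectation (active_bits \<zeta> t)"
    using eventually_gt_at_top[of 0]
  proof eventually_elim
    case (elim t)
    have "\<forall>\<^sub>F k in sequentially. p k < 1 / t"
      using order_tendstoD(2)[OF p0, of "1 / t"] elim by simp
    then obtain k0 where "p k0 < 1 / t"
      by (auto simp: eventually_sequentially)
    then have ex: "\<exists>k. p k * t \<le> 1"
      using elim by (intro exI[of _ k0]) (simp add: field_simps)
    define m where "m = (LEAST k. p k * t \<le> 1)"
    have m: "p m * t \<le> 1"
      unfolding m_def by (rule LeastI_ex[OF ex])
    have "K < m"
    proof (rule ccontr)
      assume "\<not> K < m"
      then have "p K * t \<le> p m * t"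
        using decseqD[OF dec, of m K] elim by (intro mult_right_mono) auto
      moreover have "1 < p K * t"
        using elim by (simp add: mult.commute)
      ultimately show False using m by linarith
    qed
    then obtain l where l: "m = Suc l" "K \<le> l"
      by (cases m) auto
    have pl: "p l * t > 1"
      using not_less_Least[of l "\<lambda>k. p k * t \<le> 1"] l by (simp add: m_def)
    have summand: "1 / (2 * exp 1) \<le> f (p k * t)" if k: "k \<in> {m..<m + J}" for k
    proof -
      have "p k * t \<le> p m * t"
        using decseqD[OF dec, of m k] k elim by (intro mult_right_mono) auto
      then have up: "p k * t \<le> 1" using m by simp
      have "p l / 2 \<le> p (l + Suc J)"
        using K[OF l(2)] rate_pos[of l] by (simp add: field_simps)
      also have "\<dots> \<le> p k"
        using decseqD[OF dec, of k "l + Suc J"] k l by simp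
      finally have "p l * t / 2 \<le> p k * t"
        using elim by (simp add: field_simps)
      then have low: "1 / 2 \<le> p k * t" using pl by simp
      have "1 / 2 * exp (- 1) \<le> p k * t * exp (- (p k * t))"
        using up low by (intro mult_mono) auto
      then show ?thesis
        by (simp add: f db_prob_def exp_minus field_simps)
    qed
    have "Z \<le> real J * (1 / (2 * exp 1))"
      unfolding J_def by (simp add: field_simps) linarith
    also have "\<dots> = (\<Sum>k\<in>{m..<m + J}. 1 / (2 * exp 1))" by simp
    also have "\<dots> \<le> (\<Sum>k\<in>{m..<m + J}. f (p k * t))"
      by (intro sum_mono summand)
    also have "\<dots> \<le> expectation (active_bits \<zeta> t)"
      using elim by (intro expectation_ge_partial) auto
    finally show ?case .
  qed
qed

text \<open>
  By \<open>(1 + 1 / k) powr \<gamma> \<le> 1 + 1 / k\<close> the difference is at most \<open>k powr (\<gamma> - 1)\<close>.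
\<close>
lemma powr_Suc_diff_tendsto_0:
  assumes "0 < \<gamma>" "\<gamma> < 1"
  shows "(\<lambda>k. real (Suc k) powr \<gamma> - real k powr \<gamma>) \<longlonglongrightarrow> 0"
proof (rule tendsto_sandwich[where f="\<lambda>_. 0" and h="\<lambda>k. real k powr (- (1 - \<gamma>))"])
  show "(\<lambda>k. real k powr (- (1 - \<gamma>))) \<longlonglongrightarrow> 0"
    by (rule tendsto_neg_powr) (use assms filterlim_real_sequentially in auto)
  show "\<forall>\<^sub>F k in sequentially. 0 \<le> real (Suc k) powr \<gamma> - real k powr \<gamma>"
    using assms by (intro always_eventually allI) (simp add: powr_mono2)
  show "\<forall>\<^sub>F k in sequentially. real (Suc k) powr \<gamma> - real k powr \<gamma> \<le> real k powr (- (1 - \<gamma>))"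
    using eventually_gt_at_top[of 0]
  proof eventually_elim
    case (elim k)
    have "real (Suc k) = real k * (1 + 1 / real k)"
      using elim by (simp add: field_simps)
    then have "real (Suc k) powr \<gamma> = (real k * (1 + 1 / real k)) powr \<gamma>"
      by (rule arg_cong)
    also have "\<dots> = real k powr \<gamma> * (1 + 1 / real k) powr \<gamma>"
      by (rule powr_mult)
    also have "\<dots> \<le> real k powr \<gamma> * (1 + 1 / real k) powr 1"
      using assms by (intro mult_left_mono powr_mono) auto
    also have "\<dots> = real k powr \<gamma> + real k powr \<gamma> / real k"
      by (simp add: field_simps)
    also have "real k powr \<gamma> / real k = real k powr (- (1 - \<gamma>))"
      using elim by (simp add: powr_diff powr_minus_divide)
    finally show ?case by simp
  qed
qed simp

lemma stretched_exponential_ratio: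
  fixes p :: "nat \<Rightarrow> real"
  assumes p: "asymp_equiv p sequentially (\<lambda>k. C * exp (- \<alpha> * real k powr \<gamma>))"
    and C: "C > 0" and \<gamma>: "0 < \<gamma>" "\<gamma> < 1"
  shows "(\<lambda>k. p (Suc k) / p k) \<longlonglongrightarrow> 1"
proof -
  let ?g = "\<lambda>k. C * exp (- \<alpha> * real k powr \<gamma>)"
  have "(\<lambda>k. exp (- \<alpha> * (real (Suc k) powr \<gamma> - real k powr \<gamma>))) \<longlonglongrightarrow> exp (- \<alpha> * 0)"
    by (intro tendsto_intros powr_Suc_diff_tendsto_0 \<gamma>)
  moreover have "exp (- \<alpha> * (real (Suc k) powr \<gamma> - real k powr \<gamma>)) = ?g (Suc k) / ?g k" for k
    using C by (simp add: right_diff_distrib flip: exp_diff)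
  ultimately have lim: "(\<lambda>k. ?g (Suc k) / ?g k) \<longlonglongrightarrow> 1"
    by simp
  have shift: "asymp_equiv (\<lambda>k. p (Suc k)) sequentially (\<lambda>k. ?g (Suc k))"
    by (rule asymp_equiv_compose'[OF p filterlim_Suc])
  have "asymp_equiv (\<lambda>k. p (Suc k) / p k) sequentially (\<lambda>k. ?g (Suc k) / ?g k)"
    by (rule asymp_equiv_divide[OF shift p])
  from tendsto_asymp_equiv_cong[OF this] lim show ?thesis
    by simp
qed

section \<open>Asymptotic normality in both models\<close>

theorem theorem2p5:
  fixes M :: "'a measure" and P :: "nat pmf" and \<zeta> :: "nat \<Rightarrow> real \<Rightarrow> 'a \<Rightarrow> nat"
  assumes "prob_space M"
    and "set_pmf P \<subseteq> {1..}"
    and "antimono_on {1..} (pmf P)"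
    and "\<not> bdd_above (set_pmf P)"
  shows "(bf_model M P \<zeta> \<or> db_model M P \<zeta> \<longrightarrow>
            filterlim (\<lambda>t. prob_space.expectation M (active_bits \<zeta> t)) at_top at_top \<longrightarrow>
            filterlim (\<lambda>t. prob_space.variance M (active_bits \<zeta> t)) at_top at_top \<and>
            weak_conv_along at_top
              (\<lambda>t. distr M borel (\<lambda>\<omega>.
                 (active_bits \<zeta> t \<omega> - prob_space.expectation M (active_bits \<zeta> t)) /
                 sqrt (prob_space.variance M (active_bits \<zeta> t))))
              std_normal_distribution) \<and>
         (bf_model M P \<zeta> \<longrightarrow>
            filterlim (\<lambda>t. prob_space.expectation M (active_bits \<zeta> t)) at_top at_top) \<and>
         (db_model M P \<zeta> \<longrightarrow>
            (\<exists>C \<alpha> \<gamma>. C > 0 \<and> \<alpha> > 0 \<and> 0 < \<gamma> \<and> \<gamma> < 1 \<and>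
               asymp_equiv (pmf P) sequentially (\<lambda>k. C * exp (- \<alpha> * real k powr \<gamma>))) \<longrightarrow>
            filterlim (\<lambda>t. prob_space.expectation M (active_bits \<zeta> t)) at_top at_top)"
proof -
  interpret prob_space M by fact
  define p where "p k = pmf P (Suc k)" for k
  have dec: "decseq p"
    using assms(3) by (auto simp: p_def decseq_def monotone_on_def)
  \<comment> \<open>A nonincreasing sequence with unbounded support has no zeros.\<close>
  have pos: "p k > 0" for k
  proof -
    obtain n where n: "n \<in> set_pmf P" "n > Suc k"
      using assms(4) unfolding bdd_above_def by (meson not_le)
    then have "0 < pmf P n"
      by (simp add: pmf_positive)
    also have "pmf P n \<le> p k"
      using assms(3) n unfolding p_def monotone_on_def by auto
    finally show ?thesis .
  qed
  have sum: "summable p"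
    unfolding p_def using summable_pmf_nat[of P] by (simp add: summable_Suc_iff)
  have bf: "bit_model M p bf_prob \<zeta>" if model: "bf_model M P \<zeta>"
  proof
    have bit: "bf_bit M (p k) (\<zeta> (Suc k))" for k
      using model unfolding bf_model_def p_def by simp
    show "{\<omega> \<in> space M. \<zeta> (Suc k) t \<omega> = 1} \<in> events" if "t > 0" for k t
      by (rule active_event_bf[OF bit]) (use that in simp)
    show "prob {\<omega> \<in> space M. \<zeta> (Suc k) t \<omega> = 1} = bf_prob (p k * t)" if "t > 0" for k t
      by (rule prob_bf_bit_active[OF bit pos that])
    show "indep_vars (\<lambda>_. borel) (\<lambda>k. indicator {\<omega> \<in> space M. \<zeta> (Suc k) t \<omega> = 1} :: 'a \<Rightarrow> real) UNIV"
      if "t > 0" for t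
      using model that unfolding bf_model_def
      by (intro indep_active_indicators[where S="{0, 1}"]) auto
  qed (use pos sum bf_prob_bounds in auto)
  have db: "bit_model M p db_prob \<zeta>" if model: "db_model M P \<zeta>"
  proof
    have bit: "db_bit M (p k) (\<zeta> (Suc k))" for k
      using model unfolding db_model_def p_def by simp
    show "{\<omega> \<in> space M. \<zeta> (Suc k) t \<omega> = 1} \<in> events" if "t > 0" for k t
      by (rule active_event_db[OF bit]) (use that in simp)
    show "prob {\<omega> \<in> space M. \<zeta> (Suc k) t \<omega> = 1} = db_prob (p k * t)" if "t > 0" for k t
      by (rule prob_db_bit_active[OF bit pos that])
    show "indep_vars (\<lambda>_. borel) (\<lambda>k. indicator {\<omega> \<in> space M. \<zeta> (Suc k) t \<omega> = 1} :: 'a \<Rightarrow> real) UNIV"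
      if "t > 0" for t
      using model that unfolding db_model_def
      by (intro indep_active_indicators[where S="{0, 1, 2}"]) auto
  qed (use pos sum db_prob_bounds in auto)
  have ratio: "(\<lambda>k. p (Suc k) / p k) \<longlonglongrightarrow> 1"
    if "asymp_equiv (pmf P) sequentially (\<lambda>k. C * exp (- \<alpha> * real k powr \<gamma>))"
      "C > 0" "0 < \<gamma>" "\<gamma> < 1" for C \<alpha> \<gamma>
    using LIMSEQ_Suc[OF stretched_exponential_ratio[OF that]] by (simp add: p_def)
  show ?thesis
    using bf db ratio bit_model.filterlim_variance bit_model.clt_active_bits
      bit_model.expectation_at_top_bf[OF _ refl] bit_model.expectation_at_top_db[OF _ refl dec]
    by blast
qed

end
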